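(* Let $X$ be a nonempty finite set and let $d:\mathbb{A}(X)\times\mathbb{A}(X)\to[0,\infty)$ be a semimetric. Then $d$ satisfies Axioms 1, 3 and 4 below if and only if $d=D^{\mu}$ for some positive measure $\mu$ on $2^X$. Axiom 1: for all $\succsim,\succsim_0,\trianglerighteq\in\mathbb{A}(X)$ such that $\succsim_0$ is in-between $\succsim$ and $\trianglerighteq$, $d(\succsim,\trianglerighteq)=d(\succsim,\succsim_0)+d(\succsim_0,\trianglerighteq)$. Axiom 3: for all $\succsim\in\mathbb{A}(X)$ and distinct $a,b\in X$: if neither $a\succ b$ nor $b\succ a$ and $\succsim\oplus(a,b)$ is defined, then $d(\succsim,\succsim\oplus(a,b))=2^{N(b,\succsim)-1}d(\succsim_{ab},\succsim_{ab}^{+})$; and if $a\succ b$, then $d(\succsim,\succsim\ominus(a,b))=2^{N(b,\succsim)}d(\succsim_{ab},\succsim_{ab}^{+})$. Axiom 4: for all $\succsim,\trianglerighteq\in\mathbb{A}(X)$ with $\succ=\vartriangleright$, $d(\succsim,\trianglerighteq)=0$.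
   Context: A binary relation on $X$ is a nonempty subset $R\subseteq X\times X$; write $x\,R\,y$ for $(x,y)\in R$. Its asymmetric part $R^>$: $x\,R^>\,y$ iff $x\,R\,y$ and not $y\,R\,x$; its symmetric part is $R\setminus R^>$. $\mathrm{Inc}(R)$ is the set of $(x,y)\in X\times X$ with neither $x\,R\,y$ nor $y\,R\,x$. $R$ is acyclic if there are no pairwise distinct $z_1,\dots,z_k$ with $z_1\,R^>\,z_2\cdots R^>\,z_k\,R^>\,z_1$. An acyclic order is a reflexive acyclic relation; $\mathbb{A}(X)$ is the set of acyclic orders on $X$. For $\succsim$ (resp. $\trianglerighteq$) in $\mathbb{A}(X)$, $\succ$ (resp. $\vartriangleright$) is its asymmetric part and $\sim$ its symmetric part. For $S\subseteq X$, $M(S,R):=\{x\in S:\text{there is no }y\in S\text{ with }y\,R^>\,x\}$. Perturbations: for $\succsim\in\mathbb{A}(X)$ and $a\neq b$: if neither $a\succ b$ nor $b\succ a$, let $R:=\succsim\cup\{(a,b)\}$ if $(a,b)\in\mathrm{Inc}(\succsim)$ and $R:=\succsim\setminus\{(b,a)\}$ if $a\sim b$; if $R$ is acyclic, $\succsim\oplus(a,b):=R$ (otherwise undefined). If $a\succ b$, $\succsim\ominus(a,b):=\succsim\setminus\{(a,b)\}$. We write $\succsim\,\rightarrow\,\succsim_0\,\twoheadrightarrow\,\trianglerighteq$ ($\succsim_0$ is a one-step perturbation of $\succsim$ toward $\trianglerighteq$) if either (i) for some $a\succ b$: $\succsim_0=\succsim\ominus(a,b)$, not $a\vartriangleright b$,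 and $x\succ b$ for every $x$ with $x\vartriangleright b$; or (ii) for some distinct $a,b$ with $(a,b)\in\mathrm{Inc}(\succ)$: $\succsim\oplus(a,b)$ is defined, equals $\succsim_0$, and $a\vartriangleright b$. For an integer $n\ge2$, $\succsim_{n-1}$ is an $n$-step perturbation of $\succsim$ toward $\trianglerighteq$ if there are $\succsim_0,\dots,\succsim_{n-2}\in\mathbb{A}(X)$ with $\succsim\rightarrow\succsim_0\twoheadrightarrow\trianglerighteq$ and $\succsim_{k-1}\rightarrow\succsim_k\twoheadrightarrow\trianglerighteq$ for $k=1,\dots,n-1$ (a $1$-step perturbation is a one-step perturbation). $\succsim_*$ is in-between $\succsim$ and $\trianglerighteq$ if it is an $n$-step perturbation of $\succsim$ toward $\trianglerighteq$ for some positive integer $n$. For distinct $a,b\in X$, $\succsim_{ab}$ is the partial order $\Delta_X\cup\big((X\setminus\{a,b\})\times\{a,b\}\big)$ (where $\Delta_X$ is the diagonal) and $\succsim_{ab}^+:=\succsim_{ab}\cup\{(a,b)\}$. For $b\in X$ and $\succsim\in\mathbb{A}(X)$, $N(b,\succsim)$ is the number of $x\in X\setminus\{b\}$ such that not $x\succ b$. A semimetric on a set $Z$ is a map $d:Z\times Z\to[0,\infty)$ with $d(z,z)=0$, $d(z,w)=d(w,z)$, and $d(z,w)\le d(z,u)+d(u,w)$ (distinct points may have distance $0$). A positive measure on $2^X$ is a map $\mu:2^X\to[0,\infty)$ with $\mu(\varnothing)=0$ and $\mu(A\cup B)=\mu(A)+\mu(B)$ for disjoint $A,B$ (the zero measure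 included). The $\mu$-top-difference semimetric is $D^{\mu}(\succsim,\trianglerighteq):=\sum_{S\subseteq X}\mu\big(M(S,\succsim)\triangle M(S,\trianglerighteq)\big)$. *)

theory Defs
  imports Complex_Main
begin

definition asym_part :: "'a rel \<Rightarrow> 'a rel" where
  "asym_part R = {(x, y). (x, y) \<in> R \<and> (y, x) \<notin> R}"

definition sym_part :: "'a rel \<Rightarrow> 'a rel" where
  "sym_part R = R - asym_part R"

definition Inc :: "'a set \<Rightarrow> 'a rel \<Rightarrow> 'a rel" where
  "Inc X R = {(x, y). x \<in> X \<and> y \<in> X \<and> (x, y) \<notin> R \<and> (y, x) \<notin> R}"

(* The list zs is z_1, ..., z_k; the index modulo k closes the cycle. *)
definition acyclic_rel :: "'a rel \<Rightarrow> bool" where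
  "acyclic_rel R \<longleftrightarrow>
    \<not> (\<exists>zs. zs \<noteq> [] \<and> distinct zs \<and>
         (\<forall>i<length zs. (zs ! i, zs ! (Suc i mod length zs)) \<in> asym_part R))"

(* For nonempty X, reflexivity makes every such relation nonempty. *)
definition acyclic_orders :: "'a set \<Rightarrow> 'a rel set" where
  "acyclic_orders X = {R. R \<subseteq> X \<times> X \<and> refl_on X R \<and> acyclic_rel R}"

definition maximal_in :: "'a set \<Rightarrow> 'a rel \<Rightarrow> 'a set" where
  "maximal_in S R = {x \<in> S. \<not> (\<exists>y\<in>S. (y, x) \<in> asym_part R)}"

(* None stands for "undefined". For R in acyclic_orders X the two inner cases are
   exhaustive: if neither (a, b) nor (b, a) lies in asym_part R, then (a, b) lies in
   Inc X R or in sym_part R. *)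
definition oplus :: "'a set \<Rightarrow> 'a rel \<Rightarrow> 'a \<Rightarrow> 'a \<Rightarrow> 'a rel option" where
  "oplus X R a b =
    (if a \<in> X \<and> b \<in> X \<and> a \<noteq> b \<and> (a, b) \<notin> asym_part R \<and> (b, a) \<notin> asym_part R then
       if (a, b) \<in> Inc X R then
         (if acyclic_rel (R \<union> {(a, b)}) then Some (R \<union> {(a, b)}) else None)
       else if (a, b) \<in> sym_part R then
         (if acyclic_rel (R - {(b, a)}) then Some (R - {(b, a)}) else None)
       else None
     else None)"

(* Only used when (a, b) \<in> asym_part R. *)
definition ominus :: "'a rel \<Rightarrow> 'a \<Rightarrow> 'a \<Rightarrow> 'a rel" where
  "ominus R a b = R - {(a, b)}"

(* R0 is a one-step perturbation of R toward T. *)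
definition one_step :: "'a set \<Rightarrow> 'a rel \<Rightarrow> 'a rel \<Rightarrow> 'a rel \<Rightarrow> bool" where
  "one_step X R R0 T \<longleftrightarrow>
    (\<exists>a b. (a, b) \<in> asym_part R \<and> R0 = ominus R a b \<and> (a, b) \<notin> asym_part T \<and>
       (\<forall>x. (x, b) \<in> asym_part T \<longrightarrow> (x, b) \<in> asym_part R)) \<or>
    (\<exists>a b. a \<noteq> b \<and> (a, b) \<in> Inc X (asym_part R) \<and> oplus X R a b = Some R0 \<and>
       (a, b) \<in> asym_part T)"

(* R' is an n-step perturbation of R toward T, for n \<ge> 1; the perturbed relations are
   numbered from 0, so that s (n - 1) = R'. *)
definition n_step :: "'a set \<Rightarrow> nat \<Rightarrow> 'a rel \<Rightarrow> 'a rel \<Rightarrow> 'a rel \<Rightarrow> bool" where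
  "n_step X n R R' T \<longleftrightarrow>
    (\<exists>s :: nat \<Rightarrow> 'a rel. (\<forall>k<n. s k \<in> acyclic_orders X) \<and>
       one_step X R (s 0) T \<and>
       (\<forall>k\<in>{1..<n}. one_step X (s (k - 1)) (s k) T) \<and>
       s (n - 1) = R')"

(* R' is in-between R and T. *)
definition in_between :: "'a set \<Rightarrow> 'a rel \<Rightarrow> 'a rel \<Rightarrow> 'a rel \<Rightarrow> bool" where
  "in_between X R R' T \<longleftrightarrow> (\<exists>n\<ge>1. n_step X n R R' T)"

definition order_ab :: "'a set \<Rightarrow> 'a \<Rightarrow> 'a \<Rightarrow> 'a rel" where
  "order_ab X a b = Id_on X \<union> (X - {a, b}) \<times> {a, b}"

definition order_ab_plus :: "'a set \<Rightarrow> 'a \<Rightarrow> 'a \<Rightarrow> 'a rel" where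
  "order_ab_plus X a b = order_ab X a b \<union> {(a, b)}"

definition N :: "'a set \<Rightarrow> 'a \<Rightarrow> 'a rel \<Rightarrow> nat" where
  "N X b R = card {x \<in> X - {b}. (x, b) \<notin> asym_part R}"

definition semimetric_on :: "'b set \<Rightarrow> ('b \<Rightarrow> 'b \<Rightarrow> real) \<Rightarrow> bool" where
  "semimetric_on Z d \<longleftrightarrow>
    (\<forall>z\<in>Z. \<forall>w\<in>Z. 0 \<le> d z w) \<and>
    (\<forall>z\<in>Z. d z z = 0) \<and>
    (\<forall>z\<in>Z. \<forall>w\<in>Z. d z w = d w z) \<and>
    (\<forall>z\<in>Z. \<forall>w\<in>Z. \<forall>u\<in>Z. d z w \<le> d z u + d u w)"

definition positive_measure :: "'a set \<Rightarrow> ('a set \<Rightarrow> real) \<Rightarrow> bool" where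
  "positive_measure X \<mu> \<longleftrightarrow>
    (\<forall>A\<in>Pow X. 0 \<le> \<mu> A) \<and> \<mu> {} = 0 \<and>
    (\<forall>A\<in>Pow X. \<forall>B\<in>Pow X. A \<inter> B = {} \<longrightarrow> \<mu> (A \<union> B) = \<mu> A + \<mu> B)"

definition top_difference :: "'a set \<Rightarrow> ('a set \<Rightarrow> real) \<Rightarrow> 'a rel \<Rightarrow> 'a rel \<Rightarrow> real" where
  "top_difference X \<mu> R T = (\<Sum>S\<in>Pow X. \<mu> (sym_diff (maximal_in S R) (maximal_in S T)))"

definition axiom1 :: "'a set \<Rightarrow> ('a rel \<Rightarrow> 'a rel \<Rightarrow> real) \<Rightarrow> bool" where
  "axiom1 X d \<longleftrightarrow>
    (\<forall>R\<in>acyclic_orders X. \<forall>R0\<in>acyclic_orders X. \<forall>T\<in>acyclic_orders X.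
       in_between X R R0 T \<longrightarrow> d R T = d R R0 + d R0 T)"

(* The natural-number exponent N X b R - 1 does not truncate: when oplus X R a b is defined,
   a itself is counted by N X b R. *)
definition axiom3 :: "'a set \<Rightarrow> ('a rel \<Rightarrow> 'a rel \<Rightarrow> real) \<Rightarrow> bool" where
  "axiom3 X d \<longleftrightarrow>
    (\<forall>R\<in>acyclic_orders X. \<forall>a\<in>X. \<forall>b\<in>X. a \<noteq> b \<longrightarrow>
       (\<forall>R'. (a, b) \<notin> asym_part R \<and> (b, a) \<notin> asym_part R \<and> oplus X R a b = Some R' \<longrightarrow>
          d R R' = 2 ^ (N X b R - 1) * d (order_ab X a b) (order_ab_plus X a b)) \<and>
       ((a, b) \<in> asym_part R \<longrightarrow>
          d R (ominus R a b) = 2 ^ N X b R * d (order_ab X a b) (order_ab_plus X a b)))"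

definition axiom4 :: "'a set \<Rightarrow> ('a rel \<Rightarrow> 'a rel \<Rightarrow> real) \<Rightarrow> bool" where
  "axiom4 X d \<longleftrightarrow>
    (\<forall>R\<in>acyclic_orders X. \<forall>T\<in>acyclic_orders X. asym_part R = asym_part T \<longrightarrow> d R T = 0)"

end

theory Submission
  imports Defs
begin

text \<open>Only the asymmetric parts \<open>P\<close>, \<open>Q\<close> of \<open>R\<close>, \<open>T\<close> matter. Removing or adding one pair \<open>(a, b)\<close>
  changes a set of maximal elements by at most \<open>b\<close>, on \<open>2 ^ k\<close> sets \<open>S\<close>, which gives Axiom 3 for
  \<open>D\<^sup>\<mu>\<close>. A one-step perturbation toward \<open>T\<close> keeps the maximal elements of every \<open>S\<close> between those
  of \<open>R\<close> and those of \<open>T\<close>; this is Axiom 1 for one step, and the triangle inequality extends it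
  to \<open>n\<close> steps.

  Conversely, adding \<open>(a, b)\<close> and \<open>(c, b)\<close> to the diagonal in the two possible orders shows that
  the distance between \<open>order_ab X a b\<close> and \<open>order_ab_plus X a b\<close> depends on \<open>b\<close> only; call it
  \<open>W b\<close>. For the measure with weights \<open>W\<close>, Axiom 3 makes \<open>d\<close> and \<open>D\<^sup>\<mu>\<close> agree on one-step
  perturbations. If \<open>P \<noteq> Q\<close>, some one-step perturbation of \<open>R\<close> toward \<open>T\<close> brings \<open>P\<close> closer to
  \<open>Q\<close>, so Axiom 1 and induction on the number of pairs in which \<open>P\<close> and \<open>Q\<close> differ finish.\<close>

subsection \<open>Acyclic orders and perturbations\<close>

text \<open>This replaces index-based cycles by the library's \<open>acyclic\<close>. For the harder
  direction, a closed walk of least positive length has no repeated vertex, so it lists a cycle of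
  pairwise distinct points.\<close>

lemma acyclic_rel_iff: "acyclic_rel R \<longleftrightarrow> acyclic (asym_part R)"
proof
  assume *: "acyclic_rel R"
  show "acyclic (asym_part R)"
  proof (rule ccontr)
    let ?r = "asym_part R"
    assume "\<not> acyclic ?r"
    then obtain x where "(x, x) \<in> ?r\<^sup>+"
      by (auto simp: acyclic_def)
    then have ex: "\<exists>n>0. \<exists>x. (x, x) \<in> ?r ^^ n"
      by (auto simp: trancl_power)
    define n where "n = (LEAST n. n > 0 \<and> (\<exists>x. (x, x) \<in> ?r ^^ n))"
    have "n > 0 \<and> (\<exists>x. (x, x) \<in> ?r ^^ n)"
      unfolding n_def using ex by (rule LeastI_ex)
    then obtain x where n: "n > 0" "(x, x) \<in> ?r ^^ n"
      by blast
    have min: "(y, y) \<notin> ?r ^^ m" if "m < n" "0 < m" for m y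
      using not_less_Least[OF that(1)[unfolded n_def]] that(2) by blast
    obtain f where f: "f 0 = x" "f n = x" "\<And>i. i < n \<Longrightarrow> (f i, f (Suc i)) \<in> ?r"
      using n(2) by (auto simp: relpow_fun_conv)
    \<comment> \<open>Otherwise the segment from \<open>i\<close> to \<open>j\<close> would be a
      shorter closed walk, against the choice of \<open>n\<close>.\<close>
    have neq: "f i \<noteq> f j" if "i < j" "j < n" for i j
    proof
      assume "f i = f j"
      moreover have "(f i, f j) \<in> ?r ^^ (j - i)"
        unfolding relpow_fun_conv using that f(3)
        by (intro exI[of _ "\<lambda>k. f (i + k)"]) auto
      ultimately show False
        using min[of "j - i" "f j"] that by (simp add: less_imp_diff_less)
    qed
    let ?zs = "map f [0..<n]"
    have "distinct ?zs"
      unfolding distinct_conv_nth using neq by (auto, metis nat_neq_iff)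
    moreover have "(?zs ! i, ?zs ! (Suc i mod length ?zs)) \<in> ?r" if "i < length ?zs" for i
      using that f(1,2) f(3)[of i] n(1) by (cases "Suc i = n") auto
    ultimately show False
      using * n(1) unfolding acyclic_rel_def by (metis length_map length_upt list.size(3) minus_nat.diff_0 less_irrefl)
  qed
next
  assume *: "acyclic (asym_part R)"
  show "acyclic_rel R"
    unfolding acyclic_rel_def
  proof clarify
    fix zs
    assume zs: "zs \<noteq> []" "\<forall>i<length zs. (zs ! i, zs ! (Suc i mod length zs)) \<in> asym_part R"
    \<comment> \<open>At the last index the modulus wraps around to \<open>0\<close>, which yields a
      loop in the transitive closure.\<close>
    have "(zs ! 0, zs ! (Suc i mod length zs)) \<in> (asym_part R)\<^sup>+" if "i < length zs" for i
      using that
    proof (induction i)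
      case 0
      then show ?case using zs by auto
    next
      case (Suc i)
      then have "(zs ! 0, zs ! Suc i) \<in> (asym_part R)\<^sup>+" by simp
      with Suc.prems zs(2) show ?case by (meson trancl.trancl_into_trancl)
    qed
    from this[of "length zs - 1"] zs(1) have "(zs ! 0, zs ! 0) \<in> (asym_part R)\<^sup>+"
      by simp
    with * show False by (simp add: acyclic_def)
  qed
qed

lemma acyclic_orders_iff:
  "R \<in> acyclic_orders X \<longleftrightarrow> R \<subseteq> X \<times> X \<and> Id_on X \<subseteq> R \<and> acyclic (asym_part R)"
  by (auto simp: acyclic_orders_def acyclic_rel_iff refl_on_def)

lemma asym_part_subset: "R \<in> acyclic_orders X \<Longrightarrow> asym_part R \<subseteq> X \<times> X"
  by (auto simp: acyclic_orders_iff asym_part_def)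

lemma asym_part_ominus:
  "(a, b) \<in> asym_part R \<Longrightarrow> asym_part (ominus R a b) = asym_part R - {(a, b)}"
  by (auto simp: asym_part_def ominus_def)

lemma ominus_in_acyclic_orders:
  assumes "R \<in> acyclic_orders X" "(a, b) \<in> asym_part R"
  shows "ominus R a b \<in> acyclic_orders X"
proof -
  have "a \<noteq> b" using assms(2) by (auto simp: asym_part_def)
  then have "Id_on X \<subseteq> ominus R a b"
    using assms(1) by (auto simp: acyclic_orders_iff ominus_def)
  moreover have "acyclic (asym_part (ominus R a b))"
    using assms by (auto simp: acyclic_orders_iff asym_part_ominus intro: acyclic_subset)
  moreover have "ominus R a b \<subseteq> X \<times> X"
    using assms by (auto simp: acyclic_orders_iff ominus_def)
  ultimately show ?thesis by (simp add: acyclic_orders_iff)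
qed

text \<open>Linking an incomparable pair and deleting one direction of a tie have the same effect on
  the asymmetric part, so later arguments need not distinguish them.\<close>

lemma oplus_Some:
  assumes "oplus X R a b = Some R'"
  shows "a \<in> X" "b \<in> X" "a \<noteq> b" "(a, b) \<notin> asym_part R" "(b, a) \<notin> asym_part R"
    and "asym_part R' = insert (a, b) (asym_part R)"
    and "R \<in> acyclic_orders X \<Longrightarrow> R' \<in> acyclic_orders X"
  using assms
  by (auto simp: oplus_def asym_part_def sym_part_def Inc_def acyclic_orders_def refl_on_def
      split: if_splits)

lemma oplus_defined:
  assumes R: "R \<in> acyclic_orders X" and ab: "a \<in> X" "b \<in> X"
    and new: "(a, b) \<notin> asym_part R" and acyc: "acyclic (insert (a, b) (asym_part R))"
  obtains R' where "oplus X R a b = Some R'"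
proof -
  have neq: "a \<noteq> b" using acyc by (auto simp: acyclic_insert)
  have ba: "(b, a) \<notin> asym_part R" using acyc by (auto simp: acyclic_insert)
  have 1: "asym_part (R \<union> {(a, b)}) = insert (a, b) (asym_part R)" if "(a, b) \<in> Inc X R"
    using that neq by (auto simp: asym_part_def Inc_def)
  have 2: "asym_part (R - {(b, a)}) = insert (a, b) (asym_part R)" if "(a, b) \<in> sym_part R"
    using that neq by (auto simp: asym_part_def sym_part_def)
  have 3: "(a, b) \<in> Inc X R \<or> (a, b) \<in> sym_part R"
    using ab new ba by (auto simp: asym_part_def sym_part_def Inc_def)
  have "\<exists>R'. oplus X R a b = Some R'"
    unfolding oplus_def using 1 2 3 acyc ab new neq ba by (auto simp: acyclic_rel_iff)
  with that show ?thesis by blast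
qed

section \<open>The reference orders\<close>

lemma acyclic_orders_by_rank:
  fixes f :: "'a \<Rightarrow> nat"
  assumes "R \<subseteq> X \<times> X" "Id_on X \<subseteq> R" "asym_part R \<subseteq> measure f"
  shows "R \<in> acyclic_orders X"
  using assms by (auto simp: acyclic_orders_iff intro: acyclic_subset[OF wf_acyclic])

lemma asym_part_order_ab: "asym_part (order_ab X a b) = (X - {a, b}) \<times> {a, b}"
  by (auto simp: asym_part_def order_ab_def)

lemma asym_part_order_ab_plus:
  "a \<noteq> b \<Longrightarrow> asym_part (order_ab_plus X a b) = insert (a, b) (asym_part (order_ab X a b))"
  by (auto simp: asym_part_def order_ab_def order_ab_plus_def)

lemma order_ab_in_acyclic_orders:
  assumes "a \<in> X" "b \<in> X"
  shows "order_ab X a b \<in> acyclic_orders X"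
proof (rule acyclic_orders_by_rank)
  show "asym_part (order_ab X a b) \<subseteq> measure (\<lambda>x. if x \<in> {a, b} then 1 else 0)"
    unfolding asym_part_order_ab by (auto split: if_splits)
qed (use assms in \<open>auto simp: order_ab_def\<close>)

lemma order_ab_plus_in_acyclic_orders:
  assumes "a \<in> X" "b \<in> X" "a \<noteq> b"
  shows "order_ab_plus X a b \<in> acyclic_orders X"
proof (rule acyclic_orders_by_rank)
  show "asym_part (order_ab_plus X a b) \<subseteq> measure (\<lambda>x. if x = b then 2 else if x = a then 1 else 0)"
    unfolding asym_part_order_ab_plus[OF assms(3)] asym_part_order_ab
    using assms(3) by (auto split: if_splits)
qed (use assms in \<open>auto simp: order_ab_plus_def order_ab_def\<close>)

lemma one_step_imp_in_between:
  "R0 \<in> acyclic_orders X \<Longrightarrow> one_step X R R0 T \<Longrightarrow> in_between X R R0 T"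
  unfolding in_between_def n_step_def
  by (intro exI[of _ "1::nat"] conjI exI[of _ "\<lambda>_. R0"]) auto

text \<open>Take \<open>b\<close> minimal for \<open>?Q\<^sup>+\<close> among the points whose
  predecessors under \<open>?P\<close> and \<open>?Q\<close> differ. If \<open>b\<close> lacks no
  \<open>?Q\<close>-predecessor, a surplus pair can be removed; otherwise a missing pair can be
  added without creating a cycle.\<close>

lemma one_step_closer:
  assumes fin: "finite X" and R: "R \<in> acyclic_orders X" and T: "T \<in> acyclic_orders X"
    and neq: "asym_part R \<noteq> asym_part T"
  obtains R0 where "R0 \<in> acyclic_orders X" "one_step X R R0 T"
    "card (sym_diff (asym_part R0) (asym_part T)) < card (sym_diff (asym_part R) (asym_part T))"
proof -
  let ?P = "asym_part R" and ?Q = "asym_part T"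
  let ?diff = "{b. ?P\<inverse> `` {b} \<noteq> ?Q\<inverse> `` {b}}"
  have sub: "?P \<subseteq> X \<times> X" "?Q \<subseteq> X \<times> X"
    using R T by (auto dest: asym_part_subset)
  have finP: "finite ?P" "finite ?Q"
    using sub fin by (auto intro: finite_subset)
  have "wf ?Q"
    using finP T by (auto simp: acyclic_orders_iff intro: finite_acyclic_wf)
  moreover obtain b0 where "b0 \<in> ?diff"
    using neq by auto
  \<comment> \<open>Minimality is taken for the transitive closure because the cycle argument below
    climbs several \<open>?Q\<close>-steps above \<open>b\<close>.\<close>
  ultimately obtain b where b: "b \<in> ?diff" and above: "\<And>c. (c, b) \<in> ?Q\<^sup>+ \<Longrightarrow> c \<notin> ?diff"
    by (rule wfE_min[OF wf_trancl]) (rule that)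
  have closer: "card (sym_diff P' ?Q) < card (sym_diff ?P ?Q)"
    if "e \<in> sym_diff ?P ?Q" "sym_diff P' ?Q = sym_diff ?P ?Q - {e}" for e P'
    unfolding that(2) using finP that(1) by (intro card_Diff1_less) auto
  show thesis
  \<comment> \<open>The inclusion is exactly the side condition for removing a pair in
    \<open>one_step\<close>.\<close>
  proof (cases "?Q\<inverse> `` {b} \<subseteq> ?P\<inverse> `` {b}")
    case True
    with b obtain a where a: "(a, b) \<in> ?P" "(a, b) \<notin> ?Q"
      by blast
    show thesis
    proof (rule that)
      show "ominus R a b \<in> acyclic_orders X"
        using R a(1) by (rule ominus_in_acyclic_orders)
      show "one_step X R (ominus R a b) T"
        unfolding one_step_def using a True by blast
      show "card (sym_diff (asym_part (ominus R a b)) ?Q) < card (sym_diff ?P ?Q)"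
        unfolding asym_part_ominus[OF a(1)]
        using a by (intro closer[of "(a, b)"]) auto
    qed
  next
    case False
    then obtain a where a: "(a, b) \<in> ?Q" "(a, b) \<notin> ?P"
      by blast
    \<comment> \<open>Above \<open>b\<close> the two relations coincide, so a \<open>P\<close>-path from \<open>b\<close> to \<open>a\<close> would be a \<open>Q\<close>-path.\<close>
    have path: "(x, b) \<in> ?Q\<^sup>+" if "(x, a) \<in> ?P\<^sup>*" for x
      using that
    proof (induction rule: converse_rtrancl_induct)
      case base
      then show ?case using a(1) by blast
    next
      case (step x y)
      then have "(x, y) \<in> ?Q" using above[of y] by blast
      with step.IH show ?case by (meson trancl_into_trancl2)
    qed
    have "(b, a) \<notin> ?P\<^sup>*"
      using path[of b] T by (auto simp: acyclic_orders_iff acyclic_def)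
    then have "acyclic (insert (a, b) ?P)"
      using R by (simp add: acyclic_insert acyclic_orders_iff)
    moreover have ab: "a \<in> X" "b \<in> X" using a sub by auto
    ultimately obtain R0 where R0: "oplus X R a b = Some R0"
      using oplus_defined R a(2) by metis
    show thesis
    proof (rule that)
      show "R0 \<in> acyclic_orders X"
        using oplus_Some(7)[OF R0 R] .
      show "one_step X R R0 T"
        unfolding one_step_def Inc_def using oplus_Some[OF R0] R0 a by blast
      show "card (sym_diff (asym_part R0) ?Q) < card (sym_diff ?P ?Q)"
        unfolding oplus_Some(6)[OF R0]
        using a by (intro closer[of "(a, b)"]) auto
    qed
  qed
qed

subsection \<open>The top-difference semimetric\<close>

lemma maximal_in_cong: "asym_part R = asym_part T \<Longrightarrow> maximal_in S R = maximal_in S T"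
  by (simp add: maximal_in_def)

lemma maximal_in_subset: "maximal_in S R \<subseteq> S"
  by (auto simp: maximal_in_def)

lemma top_difference_commute: "top_difference X \<mu> R T = top_difference X \<mu> T R"
  by (simp add: top_difference_def Un_commute)

lemma top_difference_eq_0:
  "positive_measure X \<mu> \<Longrightarrow> asym_part R = asym_part T \<Longrightarrow> top_difference X \<mu> R T = 0"
  by (simp add: top_difference_def positive_measure_def maximal_in_cong[of R T])

text \<open>The new pair can dislodge only \<open>b\<close>, and does so on those \<open>S\<close>
  that contain \<open>a\<close> and have \<open>b\<close> maximal. Such an \<open>S\<close> consists
  of \<open>a\<close>, \<open>b\<close> and an arbitrary set of other points not above
  \<open>b\<close>, which leaves \<open>N X b R - 1\<close> free choices.\<close>

lemma top_difference_insert: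
  assumes fin: "finite X" and \<mu>: "positive_measure X \<mu>"
    and ab: "a \<in> X" "b \<in> X" "a \<noteq> b" "(a, b) \<notin> asym_part R"
    and R': "asym_part R' = insert (a, b) (asym_part R)"
  shows "top_difference X \<mu> R R' = 2 ^ (N X b R - 1) * \<mu> {b}"
proof -
  let ?Y = "{x \<in> X - {b}. (x, b) \<notin> asym_part R}"
  let ?F = "{S \<in> Pow X. a \<in> S \<and> b \<in> maximal_in S R}"
  have bb: "(b, b) \<notin> asym_part R" by (simp add: asym_part_def)
  have diff: "sym_diff (maximal_in S R) (maximal_in S R') = (if S \<in> ?F then {b} else {})"
    if "S \<in> Pow X" for S
    using that R' by (auto simp: maximal_in_def)
  have "top_difference X \<mu> R R' = (\<Sum>S\<in>Pow X. if S \<in> ?F then \<mu> {b} else 0)"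
    unfolding top_difference_def using \<mu>
    by (intro sum.cong refl) (simp add: diff positive_measure_def del: mem_Collect_eq Pow_iff)
  also have "\<dots> = card ?F * \<mu> {b}"
    using fin by (subst sum.inter_restrict[symmetric]) (auto simp: Int_def)
  also have "?F = (\<union>) {a, b} ` Pow (?Y - {a})"
  proof
    show "?F \<subseteq> (\<union>) {a, b} ` Pow (?Y - {a})"
    proof
      fix S assume "S \<in> ?F"
      then have "S = {a, b} \<union> (S - {a, b})" "S - {a, b} \<in> Pow (?Y - {a})"
        by (auto simp: maximal_in_def)
      then show "S \<in> (\<union>) {a, b} ` Pow (?Y - {a})" by blast
    qed
    show "(\<union>) {a, b} ` Pow (?Y - {a}) \<subseteq> ?F"
      using ab bb by (auto simp: maximal_in_def)
  qed
  also have "card \<dots> = 2 ^ card (?Y - {a})"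
    using fin by (subst card_image) (auto simp: card_Pow inj_on_def)
  also have "card (?Y - {a}) = N X b R - 1"
    unfolding N_def using ab by (intro card_Diff_singleton) auto
  finally show ?thesis by simp
qed

text \<open>By symmetry this is the insertion of \<open>(a, b)\<close> into
  \<open>ominus R a b\<close>, where \<open>a\<close> is one more point not above \<open>b\<close>;
  this cancels the \<open>- 1\<close> in the exponent.\<close>

lemma top_difference_remove:
  assumes fin: "finite X" and \<mu>: "positive_measure X \<mu>"
    and R: "R \<in> acyclic_orders X" and ab: "(a, b) \<in> asym_part R"
  shows "top_difference X \<mu> R (ominus R a b) = 2 ^ N X b R * \<mu> {b}"
proof -
  have X: "a \<in> X" "b \<in> X" "a \<noteq> b"
    using asym_part_subset[OF R] ab by (auto simp: asym_part_def)
  have "{x \<in> X - {b}. (x, b) \<notin> asym_part (ominus R a b)}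
      = insert a {x \<in> X - {b}. (x, b) \<notin> asym_part R}"
    using X by (auto simp: asym_part_ominus[OF ab])
  then have N: "N X b (ominus R a b) = Suc (N X b R)"
    unfolding N_def using fin ab by simp
  have "top_difference X \<mu> (ominus R a b) R = 2 ^ (N X b (ominus R a b) - 1) * \<mu> {b}"
    using X ab by (intro top_difference_insert fin \<mu>) (auto simp: asym_part_ominus)
  then show ?thesis
    by (simp add: N top_difference_commute)
qed

lemma N_order_ab:
  assumes "a \<in> X" "a \<noteq> b"
  shows "N X b (order_ab X a b) = 1"
proof -
  have "{x \<in> X - {b}. (x, b) \<notin> asym_part (order_ab X a b)} = {a}"
    using assms by (auto simp: asym_part_order_ab)
  then show ?thesis by (simp add: N_def)
qed

lemma top_difference_order_ab:
  assumes "finite X" "positive_measure X \<mu>" "a \<in> X" "b \<in> X" "a \<noteq> b"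
  shows "top_difference X \<mu> (order_ab X a b) (order_ab_plus X a b) = \<mu> {b}"
  using assms top_difference_insert[OF assms(1-5) _ asym_part_order_ab_plus]
  by (simp add: N_order_ab asym_part_order_ab)

text \<open>Only the status of \<open>b\<close> can change. If a removal makes \<open>b\<close>
  maximal in \<open>S\<close>, then \<open>b\<close> is maximal for \<open>T\<close> too, since its
  \<open>T\<close>-predecessors are \<open>R\<close>-predecessors other than \<open>a\<close>. If an
  addition dislodges \<open>b\<close>, then \<open>a\<close> lies in \<open>S\<close> and dislodges
  it for \<open>T\<close> as well.\<close>

lemma one_step_maximal_in_between:
  assumes "one_step X R R0 T"
  shows "maximal_in S R \<inter> maximal_in S T \<subseteq> maximal_in S R0"
    and "maximal_in S R0 \<subseteq> maximal_in S R \<union> maximal_in S T"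
proof -
  have "maximal_in S R \<inter> maximal_in S T \<subseteq> maximal_in S R0
    \<and> maximal_in S R0 \<subseteq> maximal_in S R \<union> maximal_in S T"
    using assms unfolding one_step_def
  proof (elim disjE exE conjE)
    fix a b
    assume "(a, b) \<in> asym_part R" "R0 = ominus R a b" "(a, b) \<notin> asym_part T"
      and *: "\<forall>x. (x, b) \<in> asym_part T \<longrightarrow> (x, b) \<in> asym_part R"
    then show ?thesis unfolding maximal_in_def by (simp add: asym_part_ominus) blast
  next
    fix a b
    assume "oplus X R a b = Some R0" "(a, b) \<in> asym_part T"
    then show ?thesis unfolding maximal_in_def by (simp add: oplus_Some(6)) blast
  qed
  then show "maximal_in S R \<inter> maximal_in S T \<subseteq> maximal_in S R0"
    and "maximal_in S R0 \<subseteq> maximal_in S R \<union> maximal_in S T" by auto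
qed

lemma top_difference_one_step:
  assumes fin: "finite X" and \<mu>: "positive_measure X \<mu>" and step: "one_step X R R0 T"
  shows "top_difference X \<mu> R T = top_difference X \<mu> R R0 + top_difference X \<mu> R0 T"
  unfolding top_difference_def sum.distrib[symmetric]
proof (rule sum.cong)
  fix S assume S: "S \<in> Pow X"
  let ?A = "maximal_in S R" and ?B = "maximal_in S T" and ?C = "maximal_in S R0"
  note between = one_step_maximal_in_between[OF step, of S]
  \<comment> \<open>Betweenness of \<open>?C\<close> makes the symmetric difference split
    disjointly, so \<open>\<mu>\<close> adds up.\<close>
  have "sym_diff ?A ?B = sym_diff ?A ?C \<union> sym_diff ?C ?B" "sym_diff ?A ?C \<inter> sym_diff ?C ?B = {}"
    using between by blast+
  moreover have "sym_diff ?A ?C \<in> Pow X" "sym_diff ?C ?B \<in> Pow X"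
    using S maximal_in_subset[of S] by blast+
  ultimately show "\<mu> (sym_diff ?A ?B) = \<mu> (sym_diff ?A ?C) + \<mu> (sym_diff ?C ?B)"
    using \<mu> unfolding positive_measure_def by metis
qed simp

subsection \<open>The axioms and the characterization\<close>

lemma axiom1_if_one_step_additive:
  assumes d: "semimetric_on (acyclic_orders X) d"
    and additive: "\<And>R R0 T. \<lbrakk>R \<in> acyclic_orders X; R0 \<in> acyclic_orders X; T \<in> acyclic_orders X;
      one_step X R R0 T\<rbrakk> \<Longrightarrow> d R T = d R R0 + d R0 T"
  shows "axiom1 X d"
  unfolding axiom1_def
proof (intro ballI impI)
  let ?A = "acyclic_orders X"
  fix R R' T
  assume R: "R \<in> ?A" and R': "R' \<in> ?A" and T: "T \<in> ?A" and between: "in_between X R R' T"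
  obtain n where n: "n \<ge> 1" and "n_step X n R R' T"
    using between by (auto simp: in_between_def)
  then obtain s where "(\<forall>k<n. s k \<in> ?A) \<and> one_step X R (s 0) T \<and>
      (\<forall>k\<in>{1..<n}. one_step X (s (k - 1)) (s k) T) \<and> s (n - 1) = R'"
    unfolding n_step_def by (elim exE)
  then have s: "\<forall>k<n. s k \<in> ?A" and first: "one_step X R (s 0) T"
    and steps: "\<forall>k\<in>{1..<n}. one_step X (s (k - 1)) (s k) T" and last: "s (n - 1) = R'"
    by auto
  have tri: "d x z \<le> d x y + d y z" if "x \<in> ?A" "y \<in> ?A" "z \<in> ?A" for x y z
    using d that unfolding semimetric_on_def by metis
  have "d R T = d R (s k) + d (s k) T" if "k < n" for k
    using that
  proof (induction k)
    case 0
    then show ?case using additive first R T s by simp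
  next
    case (Suc k)
    then have "d R T = d R (s k) + (d (s k) (s (Suc k)) + d (s (Suc k)) T)"
      using additive[of "s k" "s (Suc k)" T] steps[rule_format, of "Suc k"] s T by simp
    \<comment> \<open>One triangle inequality bounds \<open>d R T\<close> from below by the sum
      through \<open>s (Suc k)\<close>, the other bounds it from above.\<close>
    with tri[of R "s k" "s (Suc k)"] tri[of R "s (Suc k)" T] Suc.prems R T s show ?case
      by (smt (verit) Suc_lessD)
  qed
  from this[of "n - 1"] n last show "d R T = d R R' + d R' T" by simp
qed

section \<open>From the axioms to a measure\<close>

lemma positive_measure_sum:
  assumes "finite X" "\<And>b. b \<in> X \<Longrightarrow> 0 \<le> W b"
  shows "positive_measure X (sum W)"
  unfolding positive_measure_def
  using assms by (auto simp: subset_iff intro!: sum_nonneg sum.union_disjoint intro: finite_subset)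

text \<open>Both orders of placing \<open>a\<close> and \<open>c\<close> above \<open>b\<close> have
  the same total length by Axiom 1. By Axiom 3 the first placement weighs twice as much as the
  second, so \<open>2 * w a + w c = 2 * w c + w a\<close> up to a common factor.\<close>

lemma order_ab_distance_independent:
  assumes fin: "finite X" and a1: "axiom1 X d" and a3: "axiom3 X d"
    and X: "a \<in> X" "b \<in> X" "c \<in> X" and neq: "a \<noteq> b" "c \<noteq> b"
  shows "d (order_ab X a b) (order_ab_plus X a b) = d (order_ab X c b) (order_ab_plus X c b)"
proof (cases "a = c")
  case False
  define w where "w x = d (order_ab X x b) (order_ab_plus X x b)" for x
  \<comment> \<open>The diagonal with the points of \<open>Y\<close> placed above \<open>b\<close>
    and no other comparisons.\<close>
  define r where "r Y = Id_on X \<union> Y \<times> {b}" for Y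
  have asym: "asym_part (r Y) = Y \<times> {b}" if "b \<notin> Y" for Y
    using that by (auto simp: asym_part_def r_def)
  have r: "r Y \<in> acyclic_orders X" if "Y \<subseteq> X" "b \<notin> Y" for Y
    using that X(2) by (intro acyclic_orders_by_rank[where f = "\<lambda>x. if x = b then 1 else 0"])
      (unfold asym[OF that(2)], auto simp: r_def)
  have oplus: "oplus X (r Y) x b = Some (r (insert x Y))"
    if "Y \<subseteq> X" "b \<notin> Y" "x \<in> X" "x \<noteq> b" "x \<notin> Y" for x Y
  proof -
    have "r (insert x Y) \<in> acyclic_orders X" using that by (intro r) auto
    then have "acyclic_rel (r (insert x Y))" by (simp add: acyclic_orders_def)
    moreover have "r (insert x Y) = r Y \<union> {(x, b)}" by (auto simp: r_def)
    moreover have "(x, b) \<in> Inc X (r Y)" using that X(2) by (auto simp: Inc_def r_def)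
    ultimately show ?thesis
      using that X(2) by (simp add: oplus_def asym)
  qed
  have step: "d (r Y) (r (insert x Y)) = 2 ^ (card (X - Y - {b}) - 1) * w x"
    if "Y \<subseteq> X" "b \<notin> Y" "x \<in> X" "x \<noteq> b" "x \<notin> Y" for x Y
  proof -
    have "{x \<in> X - {b}. (x, b) \<notin> asym_part (r Y)} = X - Y - {b}"
      using that asym[of Y] by auto
    then have "N X b (r Y) = card (X - Y - {b})" by (simp add: N_def)
    moreover have "d (r Y) (r (insert x Y)) = 2 ^ (N X b (r Y) - 1) * w x"
      using a3 r[OF that(1,2)] that(3,4) X(2) oplus[OF that] oplus_Some(4,5)[OF oplus[OF that]]
      unfolding axiom3_def w_def by blast
    ultimately show ?thesis by simp
  qed
  have route: "d (r {}) (r {x, y}) = 2 ^ (card (X - {b}) - 1) * w x + 2 ^ (card (X - {b, x}) - 1) * w y"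
    if "x \<in> X" "y \<in> X" "x \<noteq> b" "y \<noteq> b" "x \<noteq> y" for x y
  proof -
    have "one_step X (r {}) (r {x}) (r {x, y})"
      unfolding one_step_def using that X(2) oplus[of "{}" x] asym[of "{}"] asym[of "{x, y}"]
      by (intro disjI2 exI[of _ x] exI[of _ b]) (simp add: Inc_def)
    then have "in_between X (r {}) (r {x}) (r {x, y})"
      using that by (intro one_step_imp_in_between r) auto
    then have "d (r {}) (r {x, y}) = d (r {}) (r {x}) + d (r {x}) (r {x, y})"
      using a1 r[of "{}"] r[of "{x}"] r[of "{x, y}"] that unfolding axiom1_def by blast
    moreover have "X - {x} - {b} = X - {b, x}" by auto
    ultimately show ?thesis
      using step[of "{}" x] step[of "{x}" y] that by (simp add: insert_commute)
  qed
  define Y where "Y = X - {a, b, c}"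
  define k where "k = card Y"
  have Y: "X - {b, a} = insert c Y" "X - {b, c} = insert a Y" "X - {b} = insert a (insert c Y)"
    using X neq False by (auto simp: Y_def)
  have "finite Y" "a \<notin> Y" "c \<notin> Y"
    using fin by (auto simp: Y_def)
  then have k: "card (insert c Y) - 1 = k" "card (insert a Y) - 1 = k"
    "card (insert a (insert c Y)) - 1 = Suc k"
    using False by (simp_all add: k_def)
  have "d (r {}) (r {a, c}) = 2 ^ Suc k * w a + 2 ^ k * w c"
    using route[OF X(1,3) neq False] unfolding Y k .
  moreover have "d (r {}) (r {a, c}) = 2 ^ Suc k * w c + 2 ^ k * w a"
    using route[OF X(3,1) neq(2,1) False[symmetric]] unfolding Y k insert_commute[of c a "{}"] .
  ultimately have "2 ^ k * w a = 2 ^ k * w c"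
    by simp
  then show ?thesis by (simp add: w_def)
qed simp

text \<open>Axiom 3 and the two explicit formulas for the top difference give the same power of two
  times the weight of \<open>b\<close>.\<close>

lemma one_step_distance:
  assumes fin: "finite X" and \<mu>: "positive_measure X \<mu>" and a3: "axiom3 X d"
    and w: "\<And>a b. \<lbrakk>a \<in> X; b \<in> X; a \<noteq> b\<rbrakk> \<Longrightarrow> d (order_ab X a b) (order_ab_plus X a b) = \<mu> {b}"
    and R: "R \<in> acyclic_orders X" and step: "one_step X R R0 T"
  shows "d R R0 = top_difference X \<mu> R R0"
  using step unfolding one_step_def
proof (elim disjE exE conjE)
  fix a b assume ab: "(a, b) \<in> asym_part R" and R0: "R0 = ominus R a b"
  have X: "a \<in> X" "b \<in> X" "a \<noteq> b"
    using asym_part_subset[OF R] ab by (auto simp: asym_part_def)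
  have "d R R0 = 2 ^ N X b R * d (order_ab X a b) (order_ab_plus X a b)"
    using a3 R X ab R0 unfolding axiom3_def by blast
  then show ?thesis
    using w[OF X] top_difference_remove[OF fin \<mu> R ab] R0 by simp
next
  fix a b assume R0: "oplus X R a b = Some R0"
  note ab = oplus_Some[OF R0]
  have "d R R0 = 2 ^ (N X b R - 1) * d (order_ab X a b) (order_ab_plus X a b)"
    using a3 R ab R0 unfolding axiom3_def by blast
  then show ?thesis
    using w[OF ab(1-3)] top_difference_insert[OF fin \<mu> ab(1-4,6)] by simp
qed

lemma axioms_imp_top_difference:
  assumes fin: "finite X" and d: "semimetric_on (acyclic_orders X) d"
    and a1: "axiom1 X d" and a3: "axiom3 X d" and a4: "axiom4 X d"
  shows "\<exists>\<mu>. positive_measure X \<mu> \<and>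
    (\<forall>R\<in>acyclic_orders X. \<forall>T\<in>acyclic_orders X. d R T = top_difference X \<mu> R T)"
proof -
  let ?A = "acyclic_orders X"
  have "\<exists>w\<ge>0. \<forall>a\<in>X - {b}. d (order_ab X a b) (order_ab_plus X a b) = w" if b: "b \<in> X" for b
  \<comment> \<open>If \<open>b\<close> is the only point, no reference pair exists and any
    nonnegative weight will do.\<close>
  proof (cases "X = {b}")
    case False
    then obtain c where c: "c \<in> X" "c \<noteq> b" using b by auto
    then have "0 \<le> d (order_ab X c b) (order_ab_plus X c b)"
      using d b order_ab_in_acyclic_orders order_ab_plus_in_acyclic_orders
      unfolding semimetric_on_def by metis
    moreover have "\<forall>a\<in>X - {b}. d (order_ab X a b) (order_ab_plus X a b)
        = d (order_ab X c b) (order_ab_plus X c b)"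
      using order_ab_distance_independent[OF fin a1 a3] b c by blast
    ultimately show ?thesis by blast
  qed auto
  then obtain W where W: "\<And>b. b \<in> X \<Longrightarrow> 0 \<le> W b"
    "\<And>a b. a \<in> X \<Longrightarrow> b \<in> X \<Longrightarrow> a \<noteq> b \<Longrightarrow> d (order_ab X a b) (order_ab_plus X a b) = W b"
    by (metis Diff_iff singletonD)
  have \<mu>: "positive_measure X (sum W)"
    using fin W(1) by (rule positive_measure_sum)
  have "d R T = top_difference X (sum W) R T" if "R \<in> ?A" "T \<in> ?A" for R T
    using that
  \<comment> \<open>\<open>T\<close> stays fixed while \<open>R\<close> moves toward it.\<close>
  proof (induction "card (sym_diff (asym_part R) (asym_part T))" arbitrary: R rule: less_induct)
    case less
    show ?case
    proof (cases "asym_part R = asym_part T")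
      case True
      then show ?thesis
        using a4 less.prems top_difference_eq_0[OF \<mu>] unfolding axiom4_def by metis
    next
      case False
      with fin less.prems obtain R0 where R0: "R0 \<in> ?A" "one_step X R R0 T"
        "card (sym_diff (asym_part R0) (asym_part T))
          < card (sym_diff (asym_part R) (asym_part T))"
        by (rule one_step_closer)
      have "d R T = d R R0 + d R0 T"
        using a1 less.prems R0 one_step_imp_in_between unfolding axiom1_def by blast
      also have "d R R0 = top_difference X (sum W) R R0"
        using W(2) less.prems(1) R0(2) by (intro one_step_distance[OF fin \<mu> a3]) auto
      also have "d R0 T = top_difference X (sum W) R0 T"
        using less R0 by blast
      finally show ?thesis
        using top_difference_one_step[OF fin \<mu> R0(2)] by simp
    qed
  qed
  with \<mu> show ?thesis by blast
qed

lemma top_difference_imp_axioms: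
  assumes fin: "finite X" and d: "semimetric_on (acyclic_orders X) d"
    and \<mu>: "positive_measure X \<mu>"
    and eq: "\<And>R T. \<lbrakk>R \<in> acyclic_orders X; T \<in> acyclic_orders X\<rbrakk> \<Longrightarrow> d R T = top_difference X \<mu> R T"
  shows "axiom1 X d" "axiom3 X d" "axiom4 X d"
proof -
  show "axiom1 X d"
    using d by (rule axiom1_if_one_step_additive) (simp add: eq top_difference_one_step[OF fin \<mu>])
  have w: "d (order_ab X a b) (order_ab_plus X a b) = \<mu> {b}"
    if "a \<in> X" "b \<in> X" "a \<noteq> b" for a b
    using that by (simp add: eq order_ab_in_acyclic_orders order_ab_plus_in_acyclic_orders
        top_difference_order_ab[OF fin \<mu>])
  show "axiom3 X d"
    unfolding axiom3_def
  proof (intro ballI impI conjI allI)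
    fix R a b R'
    assume R: "R \<in> acyclic_orders X"
      and "(a, b) \<notin> asym_part R \<and> (b, a) \<notin> asym_part R \<and> oplus X R a b = Some R'"
    then have R': "oplus X R a b = Some R'" by blast
    note ab = oplus_Some[OF R']
    show "d R R' = 2 ^ (N X b R - 1) * d (order_ab X a b) (order_ab_plus X a b)"
      using ab(7) R w[OF ab(1-3)] top_difference_insert[OF fin \<mu> ab(1-4,6)] by (simp add: eq)
  next
    fix R a b
    assume "R \<in> acyclic_orders X" "a \<in> X" "b \<in> X" "a \<noteq> b" "(a, b) \<in> asym_part R"
    then show "d R (ominus R a b) = 2 ^ N X b R * d (order_ab X a b) (order_ab_plus X a b)"
      by (simp add: w eq ominus_in_acyclic_orders top_difference_remove[OF fin \<mu>])
  qed
  show "axiom4 X d"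
    unfolding axiom4_def by (simp add: eq top_difference_eq_0[OF \<mu>])
qed

theorem theorem3p1:
  fixes X :: "'a set" and d :: "'a rel \<Rightarrow> 'a rel \<Rightarrow> real"
  assumes "finite X" and "X \<noteq> {}"
    and "semimetric_on (acyclic_orders X) d"
  shows "axiom1 X d \<and> axiom3 X d \<and> axiom4 X d \<longleftrightarrow>
    (\<exists>\<mu>. positive_measure X \<mu> \<and>
       (\<forall>R\<in>acyclic_orders X. \<forall>T\<in>acyclic_orders X. d R T = top_difference X \<mu> R T))"
  using axioms_imp_top_difference[OF assms(1,3)] top_difference_imp_axioms[OF assms(1,3)]
  by blast

end
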